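(* For every integer $n\ge 2$, $$F_n(1)=F_{n-1}(1)-(n-1)F_{n-2}(1).$$
   Context: Let $S_n$ be the symmetric group on $[n]=\{1,\dots,n\}$ and $\mathscr{I}_n\subseteq S_n$ the set of involutions, i.e. permutations $\sigma$ with $\sigma^2=\mathrm{id}$ (the identity included). For $\sigma\in S_n$, $\mathrm{ris}(\sigma)$ is the number of $i\in\{1,\dots,n-1\}$ with $\sigma(i)<\sigma(i+1)$, and $\mathrm{sgn}(\sigma)$ is the sign of $\sigma$. The signed Eulerian polynomial on involutions is $F_n(t)=\sum_{\sigma\in\mathscr{I}_n}\mathrm{sgn}(\sigma)\,t^{\mathrm{ris}(\sigma)}$, with $F_0(t)=1$; thus $F_n(1)$ is the number of even involutions minus the number of odd involutions in $\mathscr{I}_n$. *)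

theory Defs
  imports "HOL-Combinatorics.Permutations" "HOL-Computational_Algebra.Polynomial"
begin

definition involutions :: "nat \<Rightarrow> (nat \<Rightarrow> nat) set" where
  "involutions n = {\<sigma>. \<sigma> permutes {1..n} \<and> \<sigma> \<circ> \<sigma> = id}"

(* The number n has to be passed explicitly: a permutation of {1..n} is a function
   on all of nat that is the identity outside {1..n}. *)
definition ris :: "nat \<Rightarrow> (nat \<Rightarrow> nat) \<Rightarrow> nat" where
  "ris n \<sigma> = card {i \<in> {1..<n}. \<sigma> i < \<sigma> (i + 1)}"

definition signed_eulerian :: "nat \<Rightarrow> int poly" where
  "signed_eulerian n = (\<Sum>\<sigma>\<in>involutions n. monom (sign \<sigma>) (ris n \<sigma>))"

(* For n = 0 the general formula gives the conventional value 1. *)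
lemma signed_eulerian_0: "signed_eulerian 0 = 1"
proof -
  have "involutions 0 = {id}"
    by (auto simp: involutions_def)
  then show ?thesis
    by (simp add: signed_eulerian_def ris_def sign_id flip: one_poly_eq_simps monom_0)
qed

end

theory Submission
  imports Defs
begin

text \<open>
  At \<open>t = 1\<close> the rises no longer matter, so \<open>F\<^sub>n(1)\<close> is the sum of the signs of the involutions of
  \<open>{1..n}\<close>. For \<open>n \<ge> 2\<close>, split this sum according to the image of \<open>n\<close>. The involutions that fix
  \<open>n\<close> are exactly the involutions of \<open>{1..n-1}\<close>, and they contribute \<open>F\<^sub>n\<^sub>-\<^sub>1(1)\<close>. An involution with
  \<open>n \<mapsto> n-1\<close> is the transposition of \<open>n-1\<close> and \<open>n\<close> times an involution of \<open>{1..n-2}\<close>; the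
  transposition flips the sign, so these contribute \<open>-F\<^sub>n\<^sub>-\<^sub>2(1)\<close>. Finally, conjugation by the
  transposition of \<open>k\<close> and \<open>n-1\<close> preserves signs and exchanges the involutions with \<open>n \<mapsto> n-1\<close>
  and those with \<open>n \<mapsto> k\<close>, so each of the \<open>n-1\<close> values \<open>k < n\<close> contributes the same
  amount \<open>-F\<^sub>n\<^sub>-\<^sub>2(1)\<close>.
\<close>

lemma poly_signed_eulerian_1:
  "poly (signed_eulerian n) 1 = (\<Sum>\<sigma>\<in>involutions n. sign \<sigma>)"
  by (simp add: signed_eulerian_def poly_sum poly_monom)

lemma finite_involutions: "finite (involutions n)"
  by (rule finite_subset[OF _ finite_permutations[of "{1..n}"]]) (auto simp: involutions_def)

lemma involutions_fixing_last:
  "{\<sigma> \<in> involutions (Suc n). \<sigma> (Suc n) = Suc n} = involutions n"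
proof -
  have "\<sigma> permutes {1..n}" if "\<sigma> permutes {1..Suc n}" "\<sigma> (Suc n) = Suc n" for \<sigma>
    by (rule permutes_superset[OF that(1)]) (use that in \<open>auto simp: le_Suc_eq\<close>)
  moreover have "\<sigma> permutes {1..Suc n}" if "\<sigma> permutes {1..n}" for \<sigma>
    by (rule permutes_subset[OF that]) auto
  moreover have "\<sigma> (Suc n) = Suc n" if "\<sigma> permutes {1..n}" for \<sigma>
    by (rule permutes_not_in[OF that]) auto
  ultimately show ?thesis
    by (auto simp: involutions_def)
qed

text \<open>
  Multiplication by the transposition of the last two points is its own inverse, it flips
  signs, and it turns an involution that moves neither of these points into one that swaps them.
\<close>

lemma sum_sign_involutions_swapping_last:
  "(\<Sum>\<sigma> | \<sigma> \<in> involutions (Suc (Suc n)) \<and> \<sigma> (Suc (Suc n)) = Suc n. sign \<sigma>)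
     = - (\<Sum>\<sigma>\<in>involutions n. sign \<sigma>)"
proof -
  define t where "t = transpose (Suc n) (Suc (Suc n))"
  have tt: "t \<circ> t = id" and t_perm: "t permutes {1..Suc (Suc n)}"
    and sign_t: "sign t = -1"
    by (auto simp: t_def sign_swap_id intro!: permutes_swap_id)
  have swap: "\<rho> \<circ> t \<in> involutions (Suc (Suc n))" "(\<rho> \<circ> t) (Suc (Suc n)) = Suc n"
    "sign (\<rho> \<circ> t) = - sign \<rho>" if "\<rho> \<in> involutions n" for \<rho>
  proof -
    have p: "\<rho> permutes {1..n}" and inv: "\<And>x. \<rho> (\<rho> x) = x"
      using that by (auto simp: involutions_def fun_eq_iff)
    have fixes_last: "\<rho> (Suc n) = Suc n" "\<rho> (Suc (Suc n)) = Suc (Suc n)"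
      by (auto intro!: permutes_not_in[OF p])
    have "\<rho> permutes {1..Suc (Suc n)}"
      by (rule permutes_subset[OF p]) auto
    then have perm: "\<rho> \<circ> t permutes {1..Suc (Suc n)}"
      by (rule permutes_compose[OF t_perm])
    have "\<rho> (t x) = t (\<rho> x)" for x
      using fixes_last inv[of x] by (auto simp: t_def transpose_def)
    then have "(\<rho> \<circ> t) \<circ> (\<rho> \<circ> t) = id"
      using tt inv by (auto simp: fun_eq_iff)
    with perm show "\<rho> \<circ> t \<in> involutions (Suc (Suc n))"
      by (simp add: involutions_def)
    show "(\<rho> \<circ> t) (Suc (Suc n)) = Suc n"
      using fixes_last by (simp add: t_def)
    have "permutation \<rho>" "permutation t"
      using p t_perm by (auto intro: permutes_imp_permutation[rotated])
    then show "sign (\<rho> \<circ> t) = - sign \<rho>"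
      by (simp add: sign_compose sign_t)
  qed
  have unswap: "\<sigma> \<circ> t \<in> involutions n"
    if \<sigma>: "\<sigma> \<in> involutions (Suc (Suc n))" "\<sigma> (Suc (Suc n)) = Suc n" for \<sigma>
  proof -
    have p: "\<sigma> permutes {1..Suc (Suc n)}" and inv: "\<And>x. \<sigma> (\<sigma> x) = x"
      using \<sigma>(1) by (auto simp: involutions_def fun_eq_iff)
    have swaps_last: "\<sigma> (Suc n) = Suc (Suc n)"
      using inv[of "Suc (Suc n)"] \<sigma>(2) by simp
    have "\<sigma> \<circ> t permutes {1..Suc (Suc n)}"
      by (rule permutes_compose[OF t_perm p])
    then have perm: "\<sigma> \<circ> t permutes {1..n}"
      by (rule permutes_superset) (use \<sigma>(2) swaps_last in \<open>auto simp: t_def le_Suc_eq\<close>)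
    have "\<sigma> (t x) = t (\<sigma> x)" for x
      using \<sigma>(2) swaps_last inv[of x] by (auto simp: t_def transpose_def)
    then have "(\<sigma> \<circ> t) \<circ> (\<sigma> \<circ> t) = id"
      using tt inv by (auto simp: fun_eq_iff)
    with perm show ?thesis
      by (simp add: involutions_def)
  qed
  have "(\<Sum>\<rho>\<in>involutions n. - sign \<rho>)
      = (\<Sum>\<sigma> | \<sigma> \<in> involutions (Suc (Suc n)) \<and> \<sigma> (Suc (Suc n)) = Suc n. sign \<sigma>)"
    by (rule sum.reindex_bij_witness[where j = "\<lambda>\<rho>. \<rho> \<circ> t" and i = "\<lambda>\<sigma>. \<sigma> \<circ> t"])
      (use swap unswap in \<open>auto simp: comp_assoc tt\<close>)
  then show ?thesis
    by (simp add: sum_negf)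
qed

text \<open>
  If \<open>j\<close> and \<open>k\<close> both differ from \<open>m\<close>, then conjugation by their transposition fixes \<open>m\<close> and
  relabels its image, which is why the sum does not depend on the image.
\<close>

lemma sum_sign_involutions_image_independent:
  assumes "j \<in> {1..n}" "k \<in> {1..n}" "j \<noteq> m" "k \<noteq> m"
  shows "(\<Sum>\<sigma> | \<sigma> \<in> involutions n \<and> \<sigma> m = j. sign \<sigma>)
       = (\<Sum>\<sigma> | \<sigma> \<in> involutions n \<and> \<sigma> m = k. sign \<sigma>)"
proof -
  define c where "c = transpose j k"
  have cc: "c \<circ> c = id" and c_perm: "c permutes {1..n}"
    using assms by (auto simp: c_def intro!: permutes_swap_id)
  have cc_apply: "c (c x) = x" for x
    by (simp add: c_def)
  have c_vals: "c m = m" "c j = k" "c k = j"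
    using assms by (auto simp: c_def)
  have conj: "c \<circ> \<sigma> \<circ> c \<in> involutions n" "sign (c \<circ> \<sigma> \<circ> c) = sign \<sigma>"
    if "\<sigma> \<in> involutions n" for \<sigma>
  proof -
    have p: "\<sigma> permutes {1..n}" and inv: "\<And>x. \<sigma> (\<sigma> x) = x"
      using that by (auto simp: involutions_def fun_eq_iff)
    have "c \<circ> \<sigma> \<circ> c permutes {1..n}"
      by (intro permutes_compose p c_perm)
    then show "c \<circ> \<sigma> \<circ> c \<in> involutions n"
      by (simp add: involutions_def fun_eq_iff cc_apply inv)
    have "permutation \<sigma>" "permutation c"
      using p c_perm by (auto intro: permutes_imp_permutation[rotated])
    then have "sign (c \<circ> \<sigma> \<circ> c) = sign \<sigma> * (sign c * sign c)"
      by (simp add: sign_compose permutation_compose)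
    also have "sign c * sign c = 1"
      by (rule sign_idempotent)
    finally show "sign (c \<circ> \<sigma> \<circ> c) = sign \<sigma>"
      by (simp only: mult_1_right)
  qed
  show ?thesis
    by (rule sum.reindex_bij_witness[where j = "\<lambda>\<sigma>. c \<circ> \<sigma> \<circ> c" and i = "\<lambda>\<sigma>. c \<circ> \<sigma> \<circ> c"])
      (use conj in \<open>auto simp: c_vals cc_apply fun_eq_iff\<close>)
qed

lemma sum_sign_involutions_recurrence:
  "(\<Sum>\<sigma>\<in>involutions (Suc (Suc n)). sign \<sigma>)
     = (\<Sum>\<sigma>\<in>involutions (Suc n). sign \<sigma>) - int (Suc n) * (\<Sum>\<sigma>\<in>involutions n. sign \<sigma>)"
proof -
  define N where "N = Suc (Suc n)"
  define S where "S k = (\<Sum>\<sigma> | \<sigma> \<in> involutions N \<and> \<sigma> N = k. sign \<sigma>)" for k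
  have "\<sigma> N \<in> {1..N}" if "\<sigma> \<in> involutions N" for \<sigma>
    using that permutes_in_image[of \<sigma> "{1..N}" N] by (auto simp: involutions_def N_def)
  then have "(\<Sum>\<sigma>\<in>involutions N. sign \<sigma>) = (\<Sum>k\<in>{1..N}. S k)"
    unfolding S_def by (intro sum.group[symmetric]) (auto simp: finite_involutions)
  also have "\<dots> = S N + (\<Sum>k\<in>{1..Suc n}. S k)"
    by (simp add: N_def)
  also have "S N = (\<Sum>\<sigma>\<in>involutions (Suc n). sign \<sigma>)"
    by (simp add: S_def N_def involutions_fixing_last)
  also have "(\<Sum>k\<in>{1..Suc n}. S k) = (\<Sum>k\<in>{1..Suc n}. S (Suc n))"
    unfolding S_def
    by (intro sum.cong refl sum_sign_involutions_image_independent) (auto simp: N_def)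
  also have "S (Suc n) = - (\<Sum>\<sigma>\<in>involutions n. sign \<sigma>)"
    by (simp add: S_def N_def sum_sign_involutions_swapping_last)
  finally show ?thesis
    by (simp add: N_def)
qed

theorem proposition6:
  fixes n :: nat
  assumes "n \<ge> 2"
  shows "poly (signed_eulerian n) 1 =
    poly (signed_eulerian (n - 1)) 1 - (int n - 1) * poly (signed_eulerian (n - 2)) 1"
proof -
  obtain m where "n = Suc (Suc m)"
    using assms by (metis One_nat_def Suc_le_D numeral_2_eq_2 Suc_le_mono)
  then show ?thesis
    by (simp add: poly_signed_eulerian_1 sum_sign_involutions_recurrence)
qed

end
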